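(* Let $f\in\mathbb{Q}_p[T]$ be a nonzero $p$-adic polynomial and $x\in\mathbb{Z}_p$. Then: (0) $1\le\kappa(f,x)\le\kappa(f)$. (1) Either $|f(x)|/\|f\|\ge 1/\kappa(f,x)$ or $|f'(x)|/\|f\|\ge1/\kappa(f,x)$. (2) For every $g\in\mathbb{Q}_p[T]$, $\frac{\|g\|}{\kappa(g,x)}\le\max\left\{\frac{\|f\|}{\kappa(f,x)},\|g-f\|\right\}$, with equality if $\|g-f\|/\|f\|<1/\kappa(f,x)$; and $\frac{\|g\|}{\kappa(g)}\le\max\left\{\frac{\|f\|}{\kappa(f)},\|g-f\|\right\}$, with equality if $\|g-f\|/\|f\|<1/\kappa(f)$. (3) For every $y\in\mathbb{Z}_p$, $\frac{1}{\kappa(f,y)}\le\max\left\{\frac1{\kappa(f,x)},|y-x|\right\}$, with equality if $\kappa(f,x)|x-y|<1$. (4) Let $\Sigma_x:=\{g\in\mathbb{Q}_p[T]: g(x)=g'(x)=0\}$ and $\Sigma:=\bigcup_{z\in\mathbb{Z}_p}\Sigma_z$. Then $\kappa(f,x)=\frac{\|f\|}{\mathrm{dist}(f,\Sigma_x)}$ and $\kappa(f)=\frac{\|f\|}{\mathrm{dist}(f,\Sigma)}$. (5) If $\kappa(f,x)|f'(x)|/\|f\|\ge1$, then $\gamma(f,x)\le\kappa(f,x)$, where $\gamma(f,x):=\max_{k\ge2}|f'(x)^{-1}f^{(k)}(x)/k!|^{1/(k-1)}$ if $f'(x)\neq0$ and $\gamma(f,x):=\infty$ otherwise.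
   Context: $|\cdot|$ is the $p$-adic absolute value ($|p|=1/p$). For $f=\sum_kf_kT^k\in\mathbb{Q}_p[T]$, $\|f\|:=\max_k|f_k|$, and $\mathrm{dist}(f,A):=\inf_{g\in A}\|f-g\|$. For nonzero $f$ and $x\in\mathbb{Z}_p$, the local condition number is $\kappa(f,x):=\|f\|/\max\{|f(x)|,|f'(x)|\}\in(0,\infty]$ (equal to $\infty$ when $f(x)=f'(x)=0$), and the global condition number is $\kappa(f):=\sup_{z\in\mathbb{Z}_p}\kappa(f,z)$. In (2), $\|g\|/\kappa(g,x)$ stands for $\max\{|g(x)|,|g'(x)|\}$ and $\|g\|/\kappa(g)$ for $\inf_{z\in\mathbb{Z}_p}\max\{|g(z)|,|g'(z)|\}$ (which agree with the quotients whenever $g\neq0$). *)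

theory Defs
  imports
    "HOL-Analysis.Analysis"
    "HOL-Computational_Algebra.Computational_Algebra"
    "Berlekamp_Zassenhaus.Finite_Field"
begin

section \<open>The ring of \<open>p\<close>-adic integers as an inverse limit\<close>

text \<open>
  The prime is \<open>p = CARD('p)\<close> for a type \<open>'p\<close> of class \<^class>\<open>prime_card\<close>.  A \<open>p\<close>-adic integer is a
  coherent sequence \<open>a\<close> of residues: \<open>a n\<close> is the canonical representative modulo \<open>p ^ n\<close>
  (the condition below forces \<open>0 \<le> a n < p ^ n\<close>).
\<close>

abbreviation prime_of :: "'p::prime_card itself \<Rightarrow> int" where
  "prime_of _ \<equiv> int CARD('p)"

typedef (overloaded) ('p::prime_card) padic_int =
  "{a :: nat \<Rightarrow> int. \<forall>n. a (Suc n) mod prime_of TYPE('p) ^ n = a n}"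
  morphisms residue Abs_padic_int
  by (rule exI[of _ "\<lambda>_. 0"]) simp

setup_lifting type_definition_padic_int

lemma prime_of_gt_1: "prime_of TYPE('p::prime_card) > 1"
  using prime_card_int[where 'a='p] prime_gt_1_int by blast

lemma residue_Suc: "residue (a :: 'p::prime_card padic_int) (Suc n) mod prime_of TYPE('p) ^ n = residue a n"
  using residue[of a] by blast

lemma residue_mod [simp]: "residue (a :: 'p::prime_card padic_int) n mod prime_of TYPE('p) ^ n = residue a n"
  by (metis mod_mod_trivial residue_Suc)

lemma residue_le:
  "m \<le> n \<Longrightarrow> residue (a :: 'p::prime_card padic_int) n mod prime_of TYPE('p) ^ m = residue a m"
proof (induction n rule: dec_induct)
  case (step n)
  have "residue a (Suc n) mod prime_of TYPE('p) ^ m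
      = residue a (Suc n) mod prime_of TYPE('p) ^ n mod prime_of TYPE('p) ^ m"
    using step by (simp add: mod_mod_cancel le_imp_power_dvd)
  then show ?case using step by (simp only: residue_Suc)
qed simp

lemma padic_int_eqI: "(\<And>n. residue a n = residue b n) \<Longrightarrow> a = b"
  by (simp add: residue_inject[symmetric] fun_eq_iff)

instantiation padic_int :: (prime_card) comm_ring_1
begin

lift_definition zero_padic_int :: "'a padic_int" is "\<lambda>_. 0" by simp

lift_definition one_padic_int :: "'a padic_int" is "\<lambda>n. 1 mod prime_of TYPE('a) ^ n"
  by (simp add: mod_mod_cancel)

lift_definition plus_padic_int :: "'a padic_int \<Rightarrow> 'a padic_int \<Rightarrow> 'a padic_int"
  is "\<lambda>a b n. (a n + b n) mod prime_of TYPE('a) ^ n"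
  by (simp add: mod_mod_cancel) (metis mod_add_eq)

lift_definition uminus_padic_int :: "'a padic_int \<Rightarrow> 'a padic_int"
  is "\<lambda>a n. (- a n) mod prime_of TYPE('a) ^ n"
  by (simp add: mod_mod_cancel) (metis mod_minus_eq)

lift_definition minus_padic_int :: "'a padic_int \<Rightarrow> 'a padic_int \<Rightarrow> 'a padic_int"
  is "\<lambda>a b n. (a n - b n) mod prime_of TYPE('a) ^ n"
  by (simp add: mod_mod_cancel) (metis mod_diff_eq)

lift_definition times_padic_int :: "'a padic_int \<Rightarrow> 'a padic_int \<Rightarrow> 'a padic_int"
  is "\<lambda>a b n. (a n * b n) mod prime_of TYPE('a) ^ n"
  by (simp add: mod_mod_cancel) (metis mod_mult_eq)

instance
proof
  fix a b c :: "'a padic_int"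
  show "a * b * c = a * (b * c)"
    by (rule padic_int_eqI) (simp add: times_padic_int.rep_eq mod_simps mult.assoc)
  show "a * b = b * a"
    by (rule padic_int_eqI) (simp add: times_padic_int.rep_eq mult.commute)
  show "1 * a = a"
    by (rule padic_int_eqI) (simp add: times_padic_int.rep_eq one_padic_int.rep_eq mod_simps)
  show "a + b + c = a + (b + c)"
    by (rule padic_int_eqI) (simp add: plus_padic_int.rep_eq mod_simps add.assoc)
  show "a + b = b + a"
    by (rule padic_int_eqI) (simp add: plus_padic_int.rep_eq add.commute)
  show "0 + a = a"
    by (rule padic_int_eqI) (simp add: plus_padic_int.rep_eq zero_padic_int.rep_eq)
  show "- a + a = 0"
    by (rule padic_int_eqI)
      (simp add: plus_padic_int.rep_eq uminus_padic_int.rep_eq zero_padic_int.rep_eq mod_simps)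
  show "a - b = a + - b"
    by (rule padic_int_eqI)
      (simp add: plus_padic_int.rep_eq uminus_padic_int.rep_eq minus_padic_int.rep_eq mod_simps)
  show "(a + b) * c = a * c + b * c"
    by (rule padic_int_eqI)
      (simp add: plus_padic_int.rep_eq times_padic_int.rep_eq mod_simps distrib_right)
  show "(0::'a padic_int) \<noteq> 1"
  proof
    assume "(0::'a padic_int) = 1"
    then have "residue (0::'a padic_int) 1 = residue (1::'a padic_int) 1" by simp
    then show False
      using prime_of_gt_1[where 'p='a]
      by (simp add: zero_padic_int.rep_eq one_padic_int.rep_eq)
  qed
qed

end

lemma residue_of_nat: "residue (of_nat k :: 'p::prime_card padic_int) n = int k mod prime_of TYPE('p) ^ n"
  by (induction k)
    (simp_all add: zero_padic_int.rep_eq plus_padic_int.rep_eq one_padic_int.rep_eq mod_simps add.commute)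

lemma padic_int_nonzero: "a \<noteq> 0 \<Longrightarrow> \<exists>n. residue a (Suc n) \<noteq> 0"
proof (rule ccontr)
  assume a: "a \<noteq> 0" and *: "\<not> (\<exists>n. residue a (Suc n) \<noteq> 0)"
  have "residue a n = 0" for n
    using * residue_Suc[of a n] by simp
  then have "a = 0" by (intro padic_int_eqI) (simp add: zero_padic_int.rep_eq)
  with a show False by simp
qed

text \<open>The exponent of \<open>p\<close> in a nonzero \<open>p\<close>-adic integer.\<close>

definition padic_ord :: "'p::prime_card padic_int \<Rightarrow> nat" where
  "padic_ord a = (LEAST n. residue a (Suc n) \<noteq> 0)"

lemma residue_eq_0_iff:
  assumes "a \<noteq> 0"
  shows "residue a n = 0 \<longleftrightarrow> n \<le> padic_ord a"
proof
  have *: "residue a (Suc (padic_ord a)) \<noteq> 0"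
    unfolding padic_ord_def using padic_int_nonzero[OF assms] by (rule LeastI_ex)
  assume "residue a n = 0"
  then show "n \<le> padic_ord a"
    using * residue_le[of "Suc (padic_ord a)" n a] by (metis mod_0 not_less_eq_eq)
next
  assume "n \<le> padic_ord a"
  show "residue a n = 0"
  proof (cases n)
    case 0
    then show ?thesis using residue_mod[of a 0] by simp
  next
    case (Suc m)
    then have "m < padic_ord a" using \<open>n \<le> padic_ord a\<close> by simp
    then show ?thesis using not_less_Least[of m] Suc unfolding padic_ord_def by blast
  qed
qed

lemma residue_dvd_iff:
  fixes a :: "'p::prime_card padic_int"
  assumes "m \<le> n"
  shows "prime_of TYPE('p) ^ m dvd residue a n \<longleftrightarrow> residue a m = 0"
  using residue_le[OF assms, of a] by (simp add: dvd_eq_mod_eq_0)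

lemma residue_mult_nonzero:
  fixes a b :: "'p::prime_card padic_int"
  assumes "a \<noteq> 0" "b \<noteq> 0"
  shows "residue (a * b) n = 0 \<longleftrightarrow> n \<le> padic_ord a + padic_ord b"
proof -
  let ?p = "prime_of TYPE('p)"
  define N where "N = Suc (n + padic_ord a + padic_ord b)"
  have p: "prime ?p" by (rule prime_card_int)
  have mult: "multiplicity ?p (residue c N) = padic_ord c" and nz: "residue c N \<noteq> 0"
    if "c \<noteq> 0" "padic_ord c < N" for c :: "'p padic_int"
  proof -
    show "residue c N \<noteq> 0" using that residue_eq_0_iff[of c N] by simp
    show "multiplicity ?p (residue c N) = padic_ord c"
      using that residue_eq_0_iff[of c]
      by (intro multiplicity_eqI) (simp_all add: residue_dvd_iff flip: power_Suc)
  qed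
  have lt: "padic_ord a < N" "padic_ord b < N" by (simp_all add: N_def)
  have "residue (a * b) n = residue (a * b) N mod ?p ^ n"
    by (rule residue_le[symmetric]) (simp add: N_def)
  also have "\<dots> = residue a N * residue b N mod ?p ^ n"
    by (simp add: times_padic_int.rep_eq mod_mod_cancel le_imp_power_dvd N_def)
  finally have "residue (a * b) n = 0 \<longleftrightarrow> ?p ^ n dvd residue a N * residue b N"
    by (simp add: dvd_eq_mod_eq_0)
  also have "\<dots> \<longleftrightarrow> n \<le> multiplicity ?p (residue a N * residue b N)"
    using nz[OF assms(1) lt(1)] nz[OF assms(2) lt(2)] p
    by (intro power_dvd_iff_le_multiplicity) (auto simp: prime_int_iff)
  also have "multiplicity ?p (residue a N * residue b N) = padic_ord a + padic_ord b"
    using nz[OF assms(1) lt(1)] nz[OF assms(2) lt(2)] p mult[OF assms(1) lt(1)] mult[OF assms(2) lt(2)]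
    by (simp add: prime_elem_multiplicity_mult_distrib)
  finally show ?thesis .
qed

instance padic_int :: (prime_card) idom
proof
  fix a b :: "'a padic_int"
  assume ab: "a \<noteq> 0" "b \<noteq> 0"
  show "a * b \<noteq> 0"
  proof
    assume "a * b = 0"
    then have "residue (a * b) (Suc (padic_ord a + padic_ord b)) = 0"
      by (simp add: zero_padic_int.rep_eq)
    then show False using residue_mult_nonzero[OF ab] by simp
  qed
qed

instance padic_int :: (prime_card) ring_char_0
proof
  show "inj (of_nat :: nat \<Rightarrow> 'a padic_int)"
  proof (rule injI)
    fix m n assume eq: "(of_nat m :: 'a padic_int) = of_nat n"
    define N where "N = Suc (m + n)"
    have "int k mod prime_of TYPE('a) ^ N = int k" if "k < N" for k
    proof -
      have "int N < 2 ^ N" by (metis less_exp of_nat_less_iff of_nat_numeral of_nat_power)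
      also have "2 ^ N \<le> prime_of TYPE('a) ^ N"
        using prime_of_gt_1[where 'p='a] by (intro power_mono) auto
      finally show ?thesis using that by simp
    qed
    from this[of m] this[of n] have "int m = int n"
      using arg_cong[OF eq, of "\<lambda>c. residue c N"] by (simp add: residue_of_nat N_def)
    then show "m = n" by simp
  qed
qed

lemma padic_ord_mult: "a \<noteq> 0 \<Longrightarrow> b \<noteq> 0 \<Longrightarrow> padic_ord (a * b) = padic_ord a + padic_ord b"
  using residue_mult_nonzero[of a b] residue_eq_0_iff[of "a * b"]
  by (metis le_antisym mult_eq_0_iff order_refl)

lemma padic_ord_add:
  assumes "a \<noteq> 0" "b \<noteq> 0" "a + b \<noteq> 0"
  shows "padic_ord (a + b) \<ge> min (padic_ord a) (padic_ord b)"
  using residue_eq_0_iff[OF assms(1), of "min (padic_ord a) (padic_ord b)"]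
    residue_eq_0_iff[OF assms(2), of "min (padic_ord a) (padic_ord b)"]
    residue_eq_0_iff[OF assms(3), of "min (padic_ord a) (padic_ord b)"]
  by (simp add: plus_padic_int.rep_eq)

definition padic_int_abs :: "'p::prime_card padic_int \<Rightarrow> real" where
  "padic_int_abs a = (if a = 0 then 0 else (1 / real CARD('p)) ^ padic_ord a)"

lemma padic_int_abs_mult: "padic_int_abs (a * b) = padic_int_abs a * padic_int_abs b"
  by (simp add: padic_int_abs_def padic_ord_mult power_add)

lemma padic_int_abs_eq_0_iff [simp]: "padic_int_abs (a :: 'p::prime_card padic_int) = 0 \<longleftrightarrow> a = 0"
  using prime_of_gt_1[where 'p='p] by (simp add: padic_int_abs_def)

lemma padic_int_abs_nonneg: "padic_int_abs a \<ge> 0"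
  by (simp add: padic_int_abs_def)

lemma padic_int_abs_add:
  "padic_int_abs (a + b :: 'p::prime_card padic_int) \<le> max (padic_int_abs a) (padic_int_abs b)"
proof (cases "a = 0 \<or> b = 0 \<or> a + b = 0")
  case True
  then show ?thesis by (auto simp: padic_int_abs_nonneg le_max_iff_disj) (simp add: padic_int_abs_def)
next
  case False
  then have "min (padic_ord a) (padic_ord b) \<le> padic_ord (a + b)" by (intro padic_ord_add) auto
  then have "(1 / real CARD('p)) ^ padic_ord (a + b) \<le> (1 / real CARD('p)) ^ min (padic_ord a) (padic_ord b)"
    using prime_of_gt_1[where 'p='p] by (intro power_decreasing) auto
  then show ?thesis using False by (auto simp: padic_int_abs_def min_def split: if_splits)
qed

section \<open>The field of \<open>p\<close>-adic numbers\<close>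

type_synonym 'p padic = "'p padic_int fract"

instance fract :: ("{idom, ring_char_0}") field_char_0
  by standard (auto simp: inj_on_def of_nat_fract eq_fract)

definition padic_abs :: "'p::prime_card padic \<Rightarrow> real" where
  "padic_abs q = (THE r. \<exists>a b. b \<noteq> 0 \<and> q = Fract a b \<and> r = padic_int_abs a / padic_int_abs b)"

lemma padic_abs_Fract:
  fixes a b :: "'p::prime_card padic_int"
  assumes "b \<noteq> 0"
  shows "padic_abs (Fract a b) = padic_int_abs a / padic_int_abs b"
  unfolding padic_abs_def
proof (rule the_equality)
  show "\<exists>c d. d \<noteq> 0 \<and> Fract a b = Fract c d \<and>
      padic_int_abs a / padic_int_abs b = padic_int_abs c / padic_int_abs d"
    using assms by blast
next
  fix r
  assume "\<exists>c d. d \<noteq> 0 \<and> Fract a b = Fract c d \<and> r = padic_int_abs c / padic_int_abs d"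
  then obtain c d where cd: "d \<noteq> 0" "Fract a b = Fract c d" "r = padic_int_abs c / padic_int_abs d"
    by blast
  then have "a * d = c * b" using assms by (simp add: eq_fract)
  then have "padic_int_abs a * padic_int_abs d = padic_int_abs c * padic_int_abs b"
    by (metis padic_int_abs_mult)
  then show "r = padic_int_abs a / padic_int_abs b" using assms cd by (simp add: frac_eq_eq)
qed

lemma padic_abs_eq_0_iff [simp]: "padic_abs x = 0 \<longleftrightarrow> x = 0"
  by (cases x) (simp add: padic_abs_Fract Zero_fract_def eq_fract)

lemma padic_abs_nonneg [simp]: "padic_abs x \<ge> 0"
  by (cases x) (simp add: padic_abs_Fract padic_int_abs_nonneg)

lemma padic_abs_mult: "padic_abs (x * y) = padic_abs x * padic_abs y"
  by (cases x; cases y) (simp add: padic_abs_Fract padic_int_abs_mult)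

lemma padic_abs_add: "padic_abs (x + y :: 'p::prime_card padic) \<le> max (padic_abs x) (padic_abs y)"
proof (cases x; cases y)
  fix a b c d :: "'p padic_int"
  assume xy: "x = Fract a b" "y = Fract c d" and nz: "b \<noteq> 0" "d \<noteq> 0"
  define B D where "B = padic_int_abs b" and "D = padic_int_abs d"
  have BD: "B > 0" "D > 0"
    using nz padic_int_abs_nonneg[of b] padic_int_abs_nonneg[of d] padic_int_abs_eq_0_iff
    unfolding B_def D_def by (metis order_le_imp_less_or_eq)+
  have "padic_int_abs (a * d + c * b) \<le> max (padic_int_abs a * D) (padic_int_abs c * B)"
    using padic_int_abs_add[of "a * d" "c * b"] by (simp add: padic_int_abs_mult B_def D_def)
  then have "padic_int_abs (a * d + c * b) / (B * D) \<le> max (padic_int_abs a / B) (padic_int_abs c / D)"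
    using BD by (simp add: le_max_iff_disj field_simps)
  then show ?thesis using nz by (simp add: xy padic_abs_Fract padic_int_abs_mult B_def D_def)
qed

lemma padic_abs_prime: "padic_abs (of_nat CARD('p) :: 'p::prime_card padic) = 1 / real CARD('p)"
proof -
  let ?a = "of_nat CARD('p) :: 'p padic_int"
  have gt: "CARD('p) > 1" using prime_of_gt_1[where 'p='p] by simp
  then have a: "?a \<noteq> 0" by simp
  have "residue ?a 1 = 0" by (simp add: residue_of_nat)
  moreover have "residue ?a 2 \<noteq> 0"
    using gt by (simp add: residue_of_nat power2_eq_square)
  ultimately have "padic_ord ?a = 1"
    using residue_eq_0_iff[OF a, of 1] residue_eq_0_iff[OF a, of 2] by simp
  moreover have "padic_ord (1 :: 'p padic_int) = 0"
    using padic_ord_mult[of "1 :: 'p padic_int" 1] by simp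
  ultimately show ?thesis using a by (simp add: of_nat_fract padic_abs_Fract padic_int_abs_def)
qed

text \<open>\<open>\<int>\<^sub>p\<close> as a subset of \<open>\<rat>\<^sub>p\<close>.\<close>

definition padic_integers :: "'p::prime_card padic set" where
  "padic_integers = range (\<lambda>a. Fract a 1)"

lemma padic_abs_padic_integers_le_1: "x \<in> padic_integers \<Longrightarrow> padic_abs (x :: 'p::prime_card padic) \<le> 1"
proof -
  assume "x \<in> padic_integers"
  then obtain a where x: "x = Fract a 1" by (auto simp: padic_integers_def)
  have "padic_ord (1 :: 'p padic_int) = 0"
    using padic_ord_mult[of "1 :: 'p padic_int" 1] by simp
  moreover have "CARD('p) \<ge> 1" using prime_of_gt_1[where 'p='p] by simp
  ultimately show "padic_abs x \<le> 1"
    by (simp add: x padic_abs_Fract padic_int_abs_def power_le_one field_simps)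
qed

section \<open>Condition numbers\<close>

definition gauss_norm :: "'p::prime_card padic poly \<Rightarrow> real" where
  "gauss_norm f = Max ((\<lambda>k. padic_abs (Polynomial.coeff f k)) ` {..degree f})"

text \<open>
  Condition numbers, distances and \<open>\<gamma>\<close> are extended nonnegative reals.  In \<^typ>\<open>ennreal\<close>,
  \<open>a / 0 = \<infinity>\<close> for \<open>a > 0\<close>, \<open>1 / \<infinity> = 0\<close> and \<open>\<infinity> * 0 = 0\<close>.
\<close>

text \<open>
  \<open>local_size f x = \<parallel>f\<parallel> / \<kappa>(f, x)\<close> and \<open>global_size f = \<parallel>f\<parallel> / \<kappa>(f)\<close> for \<open>f \<noteq> 0\<close>, with \<open>\<kappa>\<close> being
  \<open>local_cond\<close> and \<open>global_cond\<close>; unlike these quotients they need no convention for \<open>f = 0\<close>.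
\<close>

definition local_size :: "'p::prime_card padic poly \<Rightarrow> 'p padic \<Rightarrow> ennreal" where
  "local_size f x = ennreal (max (padic_abs (poly f x)) (padic_abs (poly (pderiv f) x)))"

definition global_size :: "'p::prime_card padic poly \<Rightarrow> ennreal" where
  "global_size f = (INF z\<in>padic_integers. local_size f z)"

definition local_cond :: "'p::prime_card padic poly \<Rightarrow> 'p padic \<Rightarrow> ennreal" where
  "local_cond f x = ennreal (gauss_norm f) / local_size f x"

definition global_cond :: "'p::prime_card padic poly \<Rightarrow> ennreal" where
  "global_cond f = (SUP z\<in>padic_integers. local_cond f z)"

definition poly_dist :: "'p::prime_card padic poly \<Rightarrow> 'p padic poly set \<Rightarrow> ennreal" where
  "poly_dist f A = (INF g\<in>A. ennreal (gauss_norm (f - g)))"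

definition singular_at :: "'p::prime_card padic \<Rightarrow> 'p padic poly set" where
  "singular_at x = {g. poly g x = 0 \<and> poly (pderiv g) x = 0}"

definition singular_locus :: "'p::prime_card padic poly set" where
  "singular_locus = (\<Union>z\<in>padic_integers. singular_at z)"

text \<open>
  All terms with \<open>k > degree f\<close> vanish, so the supremum over \<open>k \<ge> 2\<close> is a maximum.
\<close>

definition smale_gamma :: "'p::prime_card padic poly \<Rightarrow> 'p padic \<Rightarrow> ennreal" where
  "smale_gamma f x =
    (if poly (pderiv f) x \<noteq> 0
     then SUP k\<in>{2..}. ennreal (root (k - 1)
            (padic_abs (inverse (poly (pderiv f) x) * (poly ((pderiv ^^ k) f) x / fact k))))
     else \<infinity>)"

end

theory Submission
  imports Defs
begin

text \<open>
  On \<open>\<int>\<^sub>p\<close> evaluation, differentiation and \<open>f \<mapsto> f\<^sup>(\<^sup>k\<^sup>) / k!\<close> are contractions for the Gauss norm, and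
  polynomials are Lipschitz with constant \<open>\<parallel>f\<parallel>\<close>.  Hence \<open>\<parallel>f\<parallel> / \<kappa>(f, x)\<close> moves by at most \<open>\<parallel>g - f\<parallel>\<close> or
  \<open>\<parallel>f\<parallel> \<bar>y - x\<bar>\<close> in the ultrametric sense, and applying this in both directions gives the equality cases.
  The distance to \<open>\<Sigma>\<^sub>x\<close> is attained by subtracting the first Taylor polynomial
  \<open>f(x) + f'(x) (T - x)\<close>, whose Gauss norm is at most \<open>max {\<bar>f(x)\<bar>, \<bar>f'(x)\<bar>}\<close>.
\<close>

section \<open>The \<open>p\<close>-adic absolute value and the Gauss norm\<close>

lemma padic_abs_0 [simp]: "padic_abs 0 = 0"
  by simp

lemma padic_abs_1 [simp]: "padic_abs 1 = 1"
  using padic_abs_mult[of 1 1] padic_abs_eq_0_iff[of 1] by simp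

text \<open>The value at \<open>- 1\<close> is a nonnegative square root of 1.\<close>

lemma padic_abs_minus [simp]: "padic_abs (- x) = padic_abs x"
proof -
  have "padic_abs (- 1 :: 'a padic) * padic_abs (- 1 :: 'a padic) = 1"
    by (simp flip: padic_abs_mult)
  then have "padic_abs (- 1 :: 'a padic) = 1"
    using padic_abs_nonneg[of "- 1 :: 'a padic"]
    by (auto simp: square_eq_1_iff)
  then show ?thesis
    using padic_abs_mult[of "- 1" x] by simp
qed

lemma padic_abs_diff: "padic_abs (x - y) \<le> max (padic_abs x) (padic_abs y)"
  using padic_abs_add[of x "- y"] by simp

lemma padic_abs_minus_commute: "padic_abs (x - y) = padic_abs (y - x)"
  using padic_abs_minus[of "x - y"] by simp

text \<open>Adding 1 cannot push the value above 1, by the ultrametric inequality. This makes the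
  binomial coefficients in divided derivatives harmless.\<close>

lemma padic_abs_of_nat_le_1: "padic_abs (of_nat n) \<le> 1"
proof (induction n)
  case (Suc n)
  then show ?case
    using padic_abs_add[of "1" "of_nat n"] by (auto simp: le_max_iff_disj)
qed simp

lemma padic_abs_inverse: "padic_abs (inverse x) = inverse (padic_abs x)"
proof (cases "x = 0")
  case False
  then have "padic_abs (inverse x) * padic_abs x = 1"
    by (simp flip: padic_abs_mult)
  then show ?thesis
    by (metis inverse_unique mult.commute)
qed simp

section \<open>Gauss norm: coefficient bounds, divided derivatives, evaluation\<close>

lemma gauss_norm_le_iff:
  assumes "0 \<le> C"
  shows "gauss_norm f \<le> C \<longleftrightarrow> (\<forall>k. padic_abs (Polynomial.coeff f k) \<le> C)"
proof -
  have "(\<forall>k\<in>{..degree f}. padic_abs (Polynomial.coeff f k) \<le> C)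
      \<longleftrightarrow> (\<forall>k. padic_abs (Polynomial.coeff f k) \<le> C)"
    using assms by (metis atMost_iff coeff_eq_0 not_le padic_abs_0)
  then show ?thesis
    unfolding gauss_norm_def by simp
qed

lemma gauss_norm_nonneg [simp]: "0 \<le> gauss_norm f"
  unfolding gauss_norm_def
  by (rule order_trans[OF padic_abs_nonneg[of "Polynomial.coeff f 0"]]) (auto intro!: Max_ge)

lemma coeff_le_gauss_norm: "padic_abs (Polynomial.coeff f k) \<le> gauss_norm f"
  using gauss_norm_le_iff[OF gauss_norm_nonneg[of f], of f] by simp

lemma gauss_norm_pos: "f \<noteq> 0 \<Longrightarrow> 0 < gauss_norm f"
  using coeff_le_gauss_norm[of f "degree f"] padic_abs_nonneg[of "Polynomial.coeff f (degree f)"]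
  by (metis leading_coeff_0_iff order_le_less order_less_le_trans padic_abs_eq_0_iff)

lemma gauss_norm_minus_commute: "gauss_norm (f - g) = gauss_norm (g - f)"
proof -
  have "gauss_norm (u - v) \<le> gauss_norm (v - u)" for u v :: "'a padic poly"
    using coeff_le_gauss_norm[of "v - u"]
    by (simp add: gauss_norm_le_iff padic_abs_minus_commute[of "Polynomial.coeff u _"])
  from this[of f g] this[of g f] show ?thesis
    by (rule antisym)
qed

lemma gauss_norm_0 [simp]: "gauss_norm 0 = 0"
  by (simp add: gauss_norm_def)

text \<open>Matches the Horner step of \<open>poly\<close>, so norm bounds go by
  \<open>pCons\<close> induction; it also computes the norm of a linear polynomial.\<close>

lemma gauss_norm_pCons: "gauss_norm (pCons a f) = max (padic_abs a) (gauss_norm f)"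
proof (rule antisym)
  have "padic_abs (Polynomial.coeff (pCons a f) k) \<le> max (padic_abs a) (gauss_norm f)" for k
    by (cases k) (simp_all add: le_max_iff_disj coeff_le_gauss_norm)
  then show "gauss_norm (pCons a f) \<le> max (padic_abs a) (gauss_norm f)"
    by (subst gauss_norm_le_iff) (simp_all add: le_max_iff_disj)
  have "padic_abs (Polynomial.coeff f k) \<le> gauss_norm (pCons a f)" for k
    using coeff_le_gauss_norm[of "pCons a f" "Suc k"] by simp
  then show "max (padic_abs a) (gauss_norm f) \<le> gauss_norm (pCons a f)"
    using coeff_le_gauss_norm[of "pCons a f" 0] by (simp add: gauss_norm_le_iff)
qed

text \<open>After division by \<open>fact k\<close>, the coefficients of \<open>f\<close> are only
  multiplied by binomial coefficients, which are integers and so have absolute value at most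
  1.\<close>

lemma gauss_norm_hasse_deriv_le:
  "gauss_norm (Polynomial.smult (inverse (fact k)) ((pderiv ^^ k) f)) \<le> gauss_norm f"
proof -
  have "Polynomial.coeff (Polynomial.smult (inverse (fact k)) ((pderiv ^^ k) f)) n
      = of_nat ((n + k) choose k) * Polynomial.coeff f (n + k)" for n
  proof -
    \<comment> \<open>The factor \<open>(n + 1) ... (n + k)\<close> produced by \<open>k\<close>
      differentiations is \<open>k!\<close> times a binomial coefficient.\<close>
    have "pochhammer (of_nat (Suc n)) k = (fact k * of_nat ((n + k) choose k) :: 'a padic)"
      by (simp add: binomial_gbinomial gbinomial_pochhammer' algebra_simps)
    then show ?thesis
      by (simp add: coeff_higher_pderiv field_simps)
  qed
  then show ?thesis
    by (auto simp: gauss_norm_le_iff padic_abs_mult intro!: mult_le_one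
        order_trans[OF mult_left_le_one_le coeff_le_gauss_norm] padic_abs_of_nat_le_1)
qed

lemma gauss_norm_pderiv_le: "gauss_norm (pderiv f) \<le> gauss_norm f"
  using gauss_norm_hasse_deriv_le[of 1 f] by simp

lemma padic_abs_poly_le:
  assumes "padic_abs x \<le> 1"
  shows "padic_abs (poly f x) \<le> gauss_norm f"
proof (induction f)
  case (pCons a f)
  have "padic_abs (x * poly f x) \<le> gauss_norm f"
    using mult_left_le_one_le[OF padic_abs_nonneg padic_abs_nonneg assms, of "poly f x"] pCons
    by (simp add: padic_abs_mult)
  then show ?case
    using padic_abs_add[of a "x * poly f x"] by (auto simp: gauss_norm_pCons)
qed simp

lemma padic_abs_poly_diff_le:
  assumes "padic_abs x \<le> 1" "padic_abs y \<le> 1"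
  shows "padic_abs (poly f y - poly f x) \<le> gauss_norm f * padic_abs (y - x)"
proof (induction f)
  case (pCons a f)
  \<comment> \<open>A discrete product rule: the induction hypothesis controls the first summand,
    the bound on \<open>poly f x\<close> the second.\<close>
  have "poly (pCons a f) y - poly (pCons a f) x = y * (poly f y - poly f x) + (y - x) * poly f x"
    by (simp add: algebra_simps)
  moreover have "padic_abs (y * (poly f y - poly f x)) \<le> gauss_norm f * padic_abs (y - x)"
    using mult_left_le_one_le[OF padic_abs_nonneg padic_abs_nonneg assms(2), of "poly f y - poly f x"] pCons
    by (simp add: padic_abs_mult)
  moreover have "padic_abs ((y - x) * poly f x) \<le> gauss_norm f * padic_abs (y - x)"
    using mult_left_mono[OF padic_abs_poly_le[OF assms(1), of f] padic_abs_nonneg[of "y - x"]]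
    by (simp add: padic_abs_mult mult.commute)
  ultimately have "padic_abs (poly (pCons a f) y - poly (pCons a f) x) \<le> gauss_norm f * padic_abs (y - x)"
    using padic_abs_add[of "y * (poly f y - poly f x)" "(y - x) * poly f x"] by simp
  also have "\<dots> \<le> gauss_norm (pCons a f) * padic_abs (y - x)"
    by (intro mult_right_mono) (auto simp: gauss_norm_pCons)
  finally show ?case .
qed simp

section \<open>Division in the extended nonnegative reals\<close>

lemma max_ennreal: "max (ennreal a) (ennreal b) = ennreal (max a b)"
  by (rule max_of_mono) (simp add: monoI ennreal_leI)

lemma ennreal_inverse_antimono: "a \<le> b \<Longrightarrow> inverse b \<le> inverse (a :: ennreal)"
proof (cases "a = 0 \<or> b = Orderings.top")
  case True
  then show ?thesis by auto
next
  case False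
  moreover assume "a \<le> b"
  ultimately have "0 < a" "b < Orderings.top" "a < Orderings.top"
    by (auto simp: zero_less_iff_neq_zero top.not_eq_extremum[symmetric] top_unique)
  with \<open>a \<le> b\<close> show ?thesis
    by (cases a; cases b) (auto simp: inverse_ennreal ennreal_leI)
qed

lemma ennreal_divide_left_antimono: "a \<le> b \<Longrightarrow> c / b \<le> c / (a :: ennreal)"
  by (simp add: divide_ennreal_def ennreal_inverse_antimono mult_left_mono)

text \<open>For finite nonzero \<open>c\<close>, the map \<open>a \<mapsto> c / a\<close> is an
  involution that exchanges 0 and infinity. It recovers sizes from condition numbers even when these
  are infinite.\<close>

lemma ennreal_divide_divide_cancel:
  fixes a c :: ennreal
  assumes "c \<noteq> 0" "c \<noteq> Orderings.top"
  shows "c / (c / a) = a"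
proof (cases "a = 0 \<or> a = Orderings.top")
  case True
  then show ?thesis using assms by (auto simp: ennreal_divide_zero ennreal_divide_top)
next
  case False
  then show ?thesis
    using assms by (cases a; cases c) (auto simp: divide_ennreal ennreal_zero_less_divide)
qed

lemma ennreal_one_divide_divide:
  fixes a c :: ennreal
  assumes "c \<noteq> 0" "c \<noteq> Orderings.top"
  shows "1 / (c / a) = a / c"
proof -
  have "a / c = c / (c / a) / c"
    using assms by (simp add: ennreal_divide_divide_cancel)
  also have "\<dots> = c * (1 / (c / a)) / c"
    by (simp add: ennreal_times_divide)
  also have "\<dots> = 1 / (c / a)"
    unfolding mult.commute[of c] by (rule mult_divide_eq_ennreal[OF assms])
  finally show ?thesis ..
qed

text \<open>The order-reversing involution \<open>a \<mapsto> c / a\<close> exchanges suprema and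
  infima: one inequality is monotonicity, the other follows by applying the involution
  again.\<close>

lemma ennreal_SUP_divide_left:
  fixes c :: ennreal
  assumes "c \<noteq> 0" "c \<noteq> Orderings.top"
  shows "(SUP z\<in>A. c / u z) = c / (INF z\<in>A. u z)"
proof (rule antisym)
  show "(SUP z\<in>A. c / u z) \<le> c / (INF z\<in>A. u z)"
    by (intro SUP_least ennreal_divide_left_antimono INF_lower)
  have "c / (SUP z\<in>A. c / u z) \<le> (INF z\<in>A. u z)"
  proof (rule INF_greatest)
    fix z assume "z \<in> A"
    then have "c / (SUP z\<in>A. c / u z) \<le> c / (c / u z)"
      by (intro ennreal_divide_left_antimono SUP_upper)
    then show "c / (SUP z\<in>A. c / u z) \<le> u z"
      using assms by (simp add: ennreal_divide_divide_cancel)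
  qed
  then have "c / (INF z\<in>A. u z) \<le> c / (c / (SUP z\<in>A. c / u z))"
    by (rule ennreal_divide_left_antimono)
  then show "c / (INF z\<in>A. u z) \<le> (SUP z\<in>A. c / u z)"
    using assms by (simp add: ennreal_divide_divide_cancel)
qed

text \<open>The isosceles principle: \<open>h < b\<close> rules out \<open>h\<close> in the second
  bound, so \<open>b \<le> a\<close>, while \<open>max b h = b\<close> in the first.\<close>

lemma ultrametric_eq:
  fixes a b h :: "'a::linorder"
  assumes "a \<le> max b h" "b \<le> max a h" "h < b"
  shows "a = max b h"
  using assms by (auto simp: max_def split: if_splits)

section \<open>Local and global size\<close>

lemma local_size_le_gauss_norm:
  assumes "padic_abs x \<le> 1"
  shows "local_size f x \<le> ennreal (gauss_norm f)"
  using padic_abs_poly_le[OF assms, of f] padic_abs_poly_le[OF assms, of "pderiv f"] gauss_norm_pderiv_le[of f]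
  by (auto simp: local_size_def intro!: ennreal_leI)

lemma local_size_add_le: "local_size (f + g) x \<le> max (local_size f x) (local_size g x)"
  using padic_abs_add[of "poly f x" "poly g x"]
    padic_abs_add[of "poly (pderiv f) x" "poly (pderiv g) x"]
  unfolding local_size_def max_ennreal pderiv_add poly_add by (intro ennreal_leI) auto

text \<open>Write \<open>g = f + (g - f)\<close> and bound the size of the difference by its
  norm.\<close>

lemma local_size_perturb:
  assumes "padic_abs x \<le> 1"
  shows "local_size g x \<le> max (local_size f x) (ennreal (gauss_norm (g - f)))"
  using local_size_add_le[of f "g - f" x] local_size_le_gauss_norm[OF assms, of "g - f"]
  by (auto simp: le_max_iff_disj)

text \<open>No infimum has to be attained: if the norm of \<open>g - f\<close> lies below
  \<open>global_size g\<close>, it drops out of the local bound at every \<open>z\<close>.\<close>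

lemma global_size_perturb:
  "global_size g \<le> max (global_size f) (ennreal (gauss_norm (g - f)))"
proof (rule ccontr)
  assume "\<not> ?thesis"
  then have f: "global_size f < global_size g" and h: "ennreal (gauss_norm (g - f)) < global_size g"
    by (auto simp: not_le)
  have "global_size g \<le> local_size f z" if "z \<in> padic_integers" for z
  proof -
    have "global_size g \<le> local_size g z"
      unfolding global_size_def using that by (rule INF_lower)
    also have "\<dots> \<le> max (local_size f z) (ennreal (gauss_norm (g - f)))"
      by (rule local_size_perturb[OF padic_abs_padic_integers_le_1[OF that]])
    finally show ?thesis
      using h by (auto simp: le_max_iff_disj)
  qed
  then have "global_size g \<le> global_size f"
    unfolding global_size_def[of f] by (rule INF_greatest)
  then show False using f by simp
qed

lemma local_size_move:
  assumes "padic_abs x \<le> 1" "padic_abs y \<le> 1"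
  shows "local_size f y \<le> max (local_size f x) (ennreal (gauss_norm f) * ennreal (padic_abs (y - x)))"
proof -
  \<comment> \<open>Allowing any \<open>g\<close> of norm at most that of \<open>f\<close> covers
    \<open>f\<close> and \<open>pderiv f\<close> with one Lipschitz constant.\<close>
  have "padic_abs (poly g y) \<le> max (padic_abs (poly g x)) (gauss_norm f * padic_abs (y - x))"
    if "gauss_norm g \<le> gauss_norm f" for g
    using padic_abs_add[of "poly g x" "poly g y - poly g x"] padic_abs_poly_diff_le[OF assms, of g]
      mult_right_mono[OF that padic_abs_nonneg[of "y - x"]]
    by auto
  from this[of f] this[of "pderiv f"] show ?thesis
    unfolding local_size_def max_ennreal ennreal_mult[OF gauss_norm_nonneg padic_abs_nonneg, symmetric]
    by (intro ennreal_leI) (auto simp: gauss_norm_pderiv_le)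
qed

section \<open>Distance to the singular polynomials\<close>

lemma poly_dist_singular_at:
  assumes "padic_abs x \<le> 1"
  shows "poly_dist f (singular_at x) = local_size f x"
proof (rule antisym)
  \<comment> \<open>Expanding the Taylor polynomial in powers of \<open>T\<close> puts
    \<open>- x f'(x)\<close> into the constant coefficient; \<open>|x| \<le> 1\<close> keeps the
    norm at most \<open>local_size f x\<close>.\<close>
  define r where "r = [:poly f x - x * poly (pderiv f) x, poly (pderiv f) x:]"
  have "f - r \<in> singular_at x"
    by (simp add: singular_at_def r_def pderiv_diff pderiv_pCons)
  then have "poly_dist f (singular_at x) \<le> ennreal (gauss_norm (f - (f - r)))"
    unfolding poly_dist_def by (rule INF_lower)
  also have "gauss_norm (f - (f - r)) = gauss_norm r"
    by simp
  also have "ennreal \<dots> \<le> local_size f x"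
    using padic_abs_diff[of "poly f x" "x * poly (pderiv f) x"]
      mult_left_le_one_le[OF padic_abs_nonneg padic_abs_nonneg assms, of "poly (pderiv f) x"]
    by (auto simp: r_def gauss_norm_pCons local_size_def padic_abs_mult intro!: ennreal_leI)
  finally show "poly_dist f (singular_at x) \<le> local_size f x" .
  show "local_size f x \<le> poly_dist f (singular_at x)"
    unfolding poly_dist_def
  proof (rule INF_greatest)
    fix g assume "g \<in> singular_at x"
    then have "local_size g x = 0"
      by (simp add: singular_at_def local_size_def)
    then show "local_size f x \<le> ennreal (gauss_norm (f - g))"
      using local_size_perturb[OF assms, of f g] by simp
  qed
qed

text \<open>An infimum over a union is the infimum of the infima over its members.\<close>

lemma poly_dist_singular_locus: "poly_dist f singular_locus = global_size f"
proof -
  have "poly_dist f singular_locus = (INF z\<in>padic_integers. poly_dist f (singular_at z))"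
    unfolding poly_dist_def singular_locus_def
    by (rule antisym) (auto intro!: INF_greatest intro: INF_lower2)
  also have "\<dots> = global_size f"
    unfolding global_size_def
    by (intro INF_cong refl poly_dist_singular_at padic_abs_padic_integers_le_1)
  finally show ?thesis .
qed

section \<open>Bound on Smale's gamma by the local condition number\<close>

lemma smale_gamma_le:
  assumes x: "padic_abs x \<le> 1" and nz: "poly (pderiv f) x \<noteq> 0"
    and le: "padic_abs (poly f x) \<le> padic_abs (poly (pderiv f) x)"
  shows "smale_gamma f x \<le> local_cond f x"
proof -
  define d where "d = padic_abs (poly (pderiv f) x)"
  have d: "0 < d"
    unfolding d_def using nz padic_abs_nonneg[of "poly (pderiv f) x"] padic_abs_eq_0_iff
    by (metis order_le_less)
  \<comment> \<open>By \<open>le\<close> the derivative realises the maximum in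
    \<open>local_size f x\<close>.\<close>
  have cond: "local_cond f x = ennreal (gauss_norm f / d)"
    using le d by (simp add: local_cond_def local_size_def divide_ennreal max_absorb2 flip: d_def)
  have ge1: "1 \<le> gauss_norm f / d"
    using padic_abs_poly_le[OF x, of "pderiv f"] gauss_norm_pderiv_le[of f] d by (simp add: d_def)
  have "ennreal (root (k - 1)
      (padic_abs (inverse (poly (pderiv f) x) * (poly ((pderiv ^^ k) f) x / fact k)))) \<le> local_cond f x"
    if k: "2 \<le> k" for k
  proof -
    have "padic_abs (poly ((pderiv ^^ k) f) x / fact k) \<le> gauss_norm f"
      using order_trans[OF padic_abs_poly_le[OF x] gauss_norm_hasse_deriv_le, of k f]
      by (simp add: field_simps)
    moreover have "padic_abs (inverse (poly (pderiv f) x) * (poly ((pderiv ^^ k) f) x / fact k))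
        = padic_abs (poly ((pderiv ^^ k) f) x / fact k) / d"
      by (simp only: padic_abs_mult padic_abs_inverse divide_inverse d_def ac_simps)
    ultimately have "padic_abs (inverse (poly (pderiv f) x) * (poly ((pderiv ^^ k) f) x / fact k))
        \<le> gauss_norm f / d"
      using d by (simp add: divide_right_mono)
    also have "\<dots> = (gauss_norm f / d) ^ 1"
      by simp
    \<comment> \<open>The quotient is at least 1 and \<open>k - 1 \<ge> 1\<close>, so raising the
      exponent only enlarges it and prepares the root to cancel.\<close>
    also have "\<dots> \<le> (gauss_norm f / d) ^ (k - 1)"
      using ge1 k by (intro power_increasing) auto
    finally have "root (k - 1) (padic_abs (inverse (poly (pderiv f) x) * (poly ((pderiv ^^ k) f) x / fact k)))
        \<le> root (k - 1) ((gauss_norm f / d) ^ (k - 1))"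
      using k by (intro real_root_le_mono) auto
    also have "\<dots> = gauss_norm f / d"
      using k ge1 by (intro real_root_power_cancel) auto
    finally show ?thesis
      unfolding cond by (rule ennreal_leI)
  qed
  then show ?thesis
    using nz by (auto simp: smale_gamma_def intro!: SUP_least)
qed

theorem theorem3p4:
  fixes f :: "'p::prime_card padic poly" and x :: "'p padic"
  assumes "f \<noteq> 0" and "x \<in> padic_integers"
  shows
    "(1 \<le> local_cond f x \<and> local_cond f x \<le> global_cond f)
     \<and> (ennreal (padic_abs (poly f x) / gauss_norm f) \<ge> 1 / local_cond f x
        \<or> ennreal (padic_abs (poly (pderiv f) x) / gauss_norm f) \<ge> 1 / local_cond f x)
     \<and> (\<forall>g :: 'p padic poly.
          local_size g x \<le> max (ennreal (gauss_norm f) / local_cond f x) (ennreal (gauss_norm (g - f)))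
        \<and> (ennreal (gauss_norm (g - f) / gauss_norm f) < 1 / local_cond f x \<longrightarrow>
             local_size g x = max (ennreal (gauss_norm f) / local_cond f x) (ennreal (gauss_norm (g - f))))
        \<and> global_size g \<le> max (ennreal (gauss_norm f) / global_cond f) (ennreal (gauss_norm (g - f)))
        \<and> (ennreal (gauss_norm (g - f) / gauss_norm f) < 1 / global_cond f \<longrightarrow>
             global_size g = max (ennreal (gauss_norm f) / global_cond f) (ennreal (gauss_norm (g - f)))))
     \<and> (\<forall>y \<in> padic_integers.
          1 / local_cond f y \<le> max (1 / local_cond f x) (ennreal (padic_abs (y - x)))
        \<and> (local_cond f x * ennreal (padic_abs (x - y)) < 1 \<longrightarrow>
             1 / local_cond f y = max (1 / local_cond f x) (ennreal (padic_abs (y - x)))))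
     \<and> (local_cond f x = ennreal (gauss_norm f) / poly_dist f (singular_at x)
        \<and> global_cond f = ennreal (gauss_norm f) / poly_dist f singular_locus)
     \<and> (local_cond f x * ennreal (padic_abs (poly (pderiv f) x)) / ennreal (gauss_norm f) \<ge> 1 \<longrightarrow>
          smale_gamma f x \<le> local_cond f x)"
proof -
  define c where "c = ennreal (gauss_norm f)"
  have N: "0 < gauss_norm f" using gauss_norm_pos[OF assms(1)] .
  have c: "c \<noteq> 0" "c \<noteq> Orderings.top" using N by (auto simp: c_def)
  have x: "padic_abs x \<le> 1" using padic_abs_padic_integers_le_1[OF assms(2)] .
  have lc: "local_cond f z = c / local_size f z" for z
    by (simp add: local_cond_def c_def)
  \<comment> \<open>From here on every condition number becomes \<open>c\<close> divided by a size,
    so the claims turn into ultrametric bounds on sizes.\<close>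
  have gc: "global_cond f = c / global_size f"
    unfolding global_cond_def global_size_def lc by (rule ennreal_SUP_divide_left[OF c])
  have cl: "c / local_cond f z = local_size f z" "1 / local_cond f z = local_size f z / c" for z
    by (simp_all add: lc ennreal_divide_divide_cancel[OF c] ennreal_one_divide_divide[OF c])
  have cg: "c / global_cond f = global_size f" "1 / global_cond f = global_size f / c"
    by (simp_all add: gc ennreal_divide_divide_cancel[OF c] ennreal_one_divide_divide[OF c])
  have div: "ennreal (a / gauss_norm f) = ennreal a / c" if "0 \<le> a" for a
    unfolding c_def using N that by (simp add: divide_ennreal)
  \<comment> \<open>The equality hypotheses for perturbations are normalised by the norm of
    \<open>f\<close>; this removes the division.\<close>
  have less: "a < b" if "a / c < b / c" for a b :: ennreal
    using that divide_right_mono_ennreal[of b a c] by (metis not_le)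

  have part0: "1 \<le> local_cond f x \<and> local_cond f x \<le> global_cond f"
  proof
    have "c / c \<le> c / local_size f x"
      using local_size_le_gauss_norm[OF x, of f]
      by (intro ennreal_divide_left_antimono) (simp add: c_def)
    then show "1 \<le> local_cond f x"
      using c by (simp add: lc top.not_eq_extremum)
    show "local_cond f x \<le> global_cond f"
      unfolding global_cond_def by (rule SUP_upper[OF assms(2)])
  qed

  have part1: "ennreal (padic_abs (poly f x) / gauss_norm f) \<ge> 1 / local_cond f x
      \<or> ennreal (padic_abs (poly (pderiv f) x) / gauss_norm f) \<ge> 1 / local_cond f x"
    unfolding cl div[OF padic_abs_nonneg] by (auto simp: local_size_def max_def)

  have part2: "local_size g x \<le> max (c / local_cond f x) (ennreal (gauss_norm (g - f)))
        \<and> (ennreal (gauss_norm (g - f) / gauss_norm f) < 1 / local_cond f x \<longrightarrow>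
             local_size g x = max (c / local_cond f x) (ennreal (gauss_norm (g - f))))
        \<and> global_size g \<le> max (c / global_cond f) (ennreal (gauss_norm (g - f)))
        \<and> (ennreal (gauss_norm (g - f) / gauss_norm f) < 1 / global_cond f \<longrightarrow>
             global_size g = max (c / global_cond f) (ennreal (gauss_norm (g - f))))" for g
  proof -
    \<comment> \<open>Exchanging \<open>f\<close> and \<open>g\<close> leaves the norm of the
      difference unchanged and supplies both bounds needed by \<open>ultrametric_eq\<close>.\<close>
    note L = local_size_perturb[OF x, of g f] local_size_perturb[OF x, of f g]
    note G = global_size_perturb[of g f] global_size_perturb[of f g]
    note eqs = ultrametric_eq[OF L[unfolded gauss_norm_minus_commute[of f g]] less]
      ultrametric_eq[OF G[unfolded gauss_norm_minus_commute[of f g]] less]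
    show ?thesis
      unfolding cl cg div[OF gauss_norm_nonneg] using L(1) G(1) eqs by blast
  qed

  have part3: "1 / local_cond f y \<le> max (1 / local_cond f x) (ennreal (padic_abs (y - x)))
        \<and> (local_cond f x * ennreal (padic_abs (x - y)) < 1 \<longrightarrow>
             1 / local_cond f y = max (1 / local_cond f x) (ennreal (padic_abs (y - x))))"
    if "y \<in> padic_integers" for y
  proof -
    define e where "e = ennreal (padic_abs (y - x))"
    have y: "padic_abs y \<le> 1" using padic_abs_padic_integers_le_1[OF that] .
    have ce: "c * e / c = e"
      unfolding mult.commute[of c] by (rule mult_divide_eq_ennreal[OF c])
    have move: "local_size f v / c \<le> max (local_size f u / c) e"
      if "local_size f v \<le> max (local_size f u) (c * e)" for u v
      using that divide_right_mono_ennreal[of "local_size f v" "local_size f u" c]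
        divide_right_mono_ennreal[of "local_size f v" "c * e" c] ce
      by (auto simp: le_max_iff_disj)
    have yx: "local_size f y / c \<le> max (local_size f x / c) e"
      by (rule move[OF local_size_move[OF x y, of f, folded c_def e_def]])
    have xy: "local_size f x / c \<le> max (local_size f y / c) e"
      by (rule move[OF local_size_move[OF y x, of f,
            unfolded padic_abs_minus_commute[of x y], folded c_def e_def]])
    have "local_size f y / c = max (local_size f x / c) e" if less1: "c / local_size f x * e < 1"
    \<comment> \<open>At a singular point the condition number is infinite, and infinity times
      \<open>e\<close> is below 1 only for \<open>e = 0\<close>; then \<open>yx\<close> forces both
      sides to vanish.\<close>
    proof (cases "local_size f x = 0")
      case True
      then have "e = 0"
        using less1 c by (cases "e = 0") (auto simp: ennreal_top_mult)
      then show ?thesis using True yx by simp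
    next
      case False
      have "local_size f x \<noteq> Orderings.top" by (simp add: local_size_def)
      \<comment> \<open>Otherwise multiplying by the reciprocal \<open>c / local_size f x\<close>
        would give \<open>1 \<le> c / local_size f x * e\<close>.\<close>
      have "e < local_size f x / c"
      proof (rule ccontr)
        assume "\<not> e < local_size f x / c"
        then have "c / local_size f x * (local_size f x / c) \<le> c / local_size f x * e"
          by (intro mult_left_mono) auto
        moreover have "c / local_size f x * (local_size f x / c) = 1"
          using c False \<open>local_size f x \<noteq> Orderings.top\<close>
          by (simp add: ennreal_times_divide ennreal_divide_times mult_divide_eq_ennreal
              top.not_eq_extremum)
        ultimately show False using less1 by simp
      qed
      then show ?thesis by (rule ultrametric_eq[OF yx xy])
    qed
    then show ?thesis
      using yx unfolding cl e_def padic_abs_minus_commute[of x y] unfolding lc by blast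
  qed

  have part5: "smale_gamma f x \<le> local_cond f x"
    if "local_cond f x * ennreal (padic_abs (poly (pderiv f) x)) / c \<ge> 1"
  proof -
    define d where "d = padic_abs (poly (pderiv f) x)"
    \<comment> \<open>A zero derivative would make the left side of the hypothesis 0, since infinity
      times 0 is 0 here.\<close>
    have "poly (pderiv f) x \<noteq> 0" using that by auto
    then have d: "0 < d"
      unfolding d_def using padic_abs_nonneg padic_abs_eq_0_iff by (metis order_le_less)
    \<comment> \<open>\<open>L\<close> is the real number behind \<open>local_size f x\<close>. The
      hypothesis becomes \<open>1 \<le> d / L\<close>, so the derivative realises the
      maximum.\<close>
    define L where "L = max (padic_abs (poly f x)) d"
    have L: "0 < L" using d by (simp add: L_def)
    have "local_cond f x = ennreal (gauss_norm f / L)"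
      using N L by (simp add: local_cond_def local_size_def divide_ennreal L_def d_def)
    then have "local_cond f x * ennreal d / c = ennreal (gauss_norm f / L * d / gauss_norm f)"
      using N L d by (simp add: c_def divide_ennreal flip: ennreal_mult)
    also have "gauss_norm f / L * d / gauss_norm f = d / L"
      using N by simp
    finally have "1 \<le> d / L"
      using that by (simp add: d_def)
    then have "L \<le> d" using L by simp
    then show ?thesis
      using \<open>poly (pderiv f) x \<noteq> 0\<close> by (intro smale_gamma_le[OF x]) (auto simp: L_def d_def)
  qed

  show ?thesis
    using part0 part1 part2 part3 part5 lc[of x] gc poly_dist_singular_at[OF x, of f]
      poly_dist_singular_locus[of f]
    unfolding c_def by simp
qed

end
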